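(* Let $N\ge 5$ be an integer. There is no $\beta>0$ for which the function $h_{N,\beta}:\mathbb Z^N\to\mathbb R$ given by $$h_{N,\beta}(n)=(|n|^2+\beta)^{-(N-2)/4}\quad(n\ne 0),\qquad h_{N,\beta}(0)=0,$$ satisfies $$-\Delta_d h_{N,\beta}(n)\ge \frac{A_N}{|n|^2}\,h_{N,\beta}(n)\qquad\text{for all } n\in\mathbb Z^N\setminus\{0\}.$$
   Context: Here $|n|$ is the Euclidean norm, $A_N=(N-2)^2/4$, and $\Delta_d$ is the discrete Laplacian on $\mathbb Z^N$: $(\Delta_d f)(n)=\sum_{j=1}^N\bigl(f(n+e_j)+f(n-e_j)-2f(n)\bigr)$, with $e_1,\dots,e_N$ the standard basis. *)

theory Defs
  imports "HOL-Analysis.Analysis"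
begin

text \<open>The lattice $Z^N$ is the type \<^typ>\<open>int ^ 'n\<close> with $N$ = \<^term>\<open>CARD('n)\<close>; its standard basis
  vectors are \<^term>\<open>axis j 1 :: int ^ 'n\<close>.\<close>

definition discrete_laplacian :: "(int ^ 'n \<Rightarrow> real) \<Rightarrow> int ^ 'n \<Rightarrow> real" where
  "discrete_laplacian f n = (\<Sum>j\<in>UNIV. f (n + axis j 1) + f (n - axis j 1) - 2 * f n)"

text \<open>The library has no norm on \<^typ>\<open>int ^ 'n\<close>, so lattice points are embedded in \<^typ>\<open>real ^ 'n\<close>.\<close>

definition lattice_norm :: "int ^ 'n \<Rightarrow> real" where
  "lattice_norm n = norm (\<chi> i. real_of_int (n $ i))"

definition hardy_const :: "nat \<Rightarrow> real" where
  "hardy_const N = (real N - 2)\<^sup>2 / 4"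

definition hardy_fun :: "real \<Rightarrow> int ^ 'n \<Rightarrow> real" where
  "hardy_fun \<beta> n =
     (if n = 0 then 0
      else ((lattice_norm n)\<^sup>2 + \<beta>) powr (- (real CARD('n) - 2) / 4))"

end

theory Submission
  imports Defs "HOL-Real_Asymp.Real_Asymp"
begin

text \<open>
  Two constraints on \<open>\<beta>\<close> contradict each other: far out along a coordinate axis the inequality forces
  \<open>\<beta>\<close> to be large, and at the single point \<open>e\<^sub>a + e\<^sub>b\<close> it forces \<open>\<beta>\<close> to be small.

  Write \<open>s = (N - 2)/4\<close>, so that \<open>A\<^sub>N = 4 s\<^sup>2\<close>, and \<open>u = |n|\<^sup>2 + \<beta>\<close>. The values of \<open>h\<close> at \<open>n\<close> and its
  neighbours are \<open>u\<^bsup>-s\<^esup>\<close> and \<open>(u + d)\<^bsup>-s\<^esup>\<close> with \<open>d = 1 \<plusminus> 2 n\<^sub>j\<close>. Taylor polynomials of odd degree at \<open>0\<close>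
  are lower bounds of \<open>(1 + x)\<^bsup>-s\<^esup>\<close>, hence the inequality at \<open>n\<close> implies a polynomial inequality
  in \<open>1/u\<close> whose coefficients are the power sums of the increments \<open>d\<close> (\<open>moment_inequality\<close>). It is
  free of irrational powers.

  At \<open>n = k e\<^sub>a\<close> the terms of order \<open>k\<^bsup>-2\<^esup>\<close> cancel, because \<open>A\<^sub>N\<close> is the sharp Hardy constant of the
  continuous problem. At order \<open>k\<^bsup>-4\<^esup>\<close> the shift contributes \<open>4 s \<beta>\<close> in favour of the inequality, and the
  leading discretisation error, a sum of pure fourth derivatives, contributes a negative amount. Letting
  \<open>k \<longlongrightarrow> \<infinity>\<close> yields \<open>4 \<beta> \<ge> (s + 1)(4 s + 2 + 4 s (s + 2)/3)\<close> (\<open>lower_bound_on_shift\<close>).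

  At \<open>n = e\<^sub>a + e\<^sub>b\<close> (\<open>pair_inequality\<close>) the first order Taylor bound, which is just convexity, already
  gives \<open>\<beta> \<le> 2 (s + 1)/s\<close>. This is incompatible with the lower bound as soon as \<open>s \<ge> 1\<close>, that is
  \<open>N \<ge> 6\<close>. For \<open>N = 5\<close> the lower bound is \<open>217/64 > 3\<close> and the convexity bound is \<open>14/3\<close>, so convexity is
  too weak; the cubic Taylor bound at the same point excludes every \<open>\<beta> > 3\<close>.
\<close>

section \<open>Taylor lower bounds for negative powers\<close>

text \<open>
  The Lagrange remainder of even order \<open>m\<close> is nonnegative: the \<open>m\<close>-th derivative of \<open>y\<^bsup>-s\<^esup>\<close> has sign
  \<open>(-1)\<^sup>m\<close> and it is multiplied by \<open>x\<^sup>m\<close>.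
\<close>

lemma powr_ge_even_taylor:
  fixes s x :: real
  assumes s: "s > 0" and x: "x > -1" and m: "even m" "m > 0"
  shows "(1 + x) powr (-s) \<ge> (\<Sum>i<m. ((-s) gchoose i) * x ^ i)"
proof (cases "x = 0")
  case True
  then show ?thesis using m by (cases m) (simp_all add: sum.lessThan_Suc_shift)
next
  case False
  define D where "D = (\<lambda>i y. (\<Prod>l<i. - s - real l) * y powr (- s - real i))"
  have deriv: "DERIV (D i) y :> D (Suc i) y" if "y > 0" for i y
    using DERIV_cmult[OF has_real_derivative_powr[OF that, of "- s - real i"],
        of "\<Prod>l<i. - s - real l"]
    by (simp add: D_def algebra_simps)
  have coeff: "D i 1 / fact i = (-s) gchoose i" for i
    by (simp add: D_def gbinomial_prod_rev lessThan_atLeast0)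
  have "\<exists>t. (if 1 + x < 1 then 1 + x < t \<and> t < 1 else 1 < t \<and> t < 1 + x) \<and>
     (1 + x) powr (-s) = (\<Sum>i<m. D i 1 / fact i * (1 + x - 1) ^ i) + D m t / fact m * (1 + x - 1) ^ m"
  proof (rule Taylor[where a = "min 1 (1 + x)" and b = "max 1 (1 + x)"])
    show "\<forall>i t. i < m \<and> min 1 (1 + x) \<le> t \<and> t \<le> max 1 (1 + x) \<longrightarrow> DERIV (D i) t :> D (Suc i) t"
      using x by (auto intro!: deriv)
  qed (use m x False in \<open>auto simp: D_def\<close>)
  then obtain t
    where eq: "(1 + x) powr (-s) = (\<Sum>i<m. D i 1 / fact i * x ^ i) + D m t / fact m * x ^ m"
    by auto
  have "(\<Prod>l<m. - s - real l) = (\<Prod>l<m. s + real l)"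
  proof -
    have "(\<Prod>l<m. - s - real l) = (\<Prod>l<m. (-1) * (s + real l))" by simp
    also have "\<dots> = (\<Prod>l<m. s + real l)"
      using m by (subst prod.distrib) simp
    finally show ?thesis .
  qed
  moreover have "(\<Prod>l<m. s + real l) \<ge> 0" using s by (intro prod_nonneg) auto
  ultimately have "D m t / fact m * x ^ m \<ge> 0"
    using m by (auto simp: D_def zero_le_even_power)
  then show ?thesis using eq by (simp add: coeff)
qed

section \<open>The inequality in terms of increments\<close>

text \<open>The power sums of the increments \<open>|n \<plusminus> e\<^sub>j|\<^sup>2 - |n|\<^sup>2 = 1 \<plusminus> 2 n\<^sub>j\<close>.\<close>

definition neighbour_moment :: "nat \<Rightarrow> int ^ 'n \<Rightarrow> real" where
  "neighbour_moment i n =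
     (\<Sum>j\<in>UNIV. (1 + 2 * real_of_int (n $ j)) ^ i + (1 - 2 * real_of_int (n $ j)) ^ i)"

lemma lattice_norm_neighbours:
  fixes n :: "int ^ 'n"
  shows "(lattice_norm (n + axis j 1))\<^sup>2 = (lattice_norm n)\<^sup>2 + (1 + 2 * real_of_int (n $ j))"
    and "(lattice_norm (n - axis j 1))\<^sup>2 = (lattice_norm n)\<^sup>2 + (1 - 2 * real_of_int (n $ j))"
proof -
  define v :: "real ^ 'n" where "v = (\<chi> i. real_of_int (n $ i))"
  have p: "(\<chi> i. real_of_int ((n + axis j 1) $ i)) = v + axis j 1"
    and q: "(\<chi> i. real_of_int ((n - axis j 1) $ i)) = v - axis j 1"
    by (auto simp: v_def vec_eq_iff axis_def)
  show "(lattice_norm (n + axis j 1))\<^sup>2 = (lattice_norm n)\<^sup>2 + (1 + 2 * real_of_int (n $ j))"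
    unfolding lattice_norm_def p v_def[symmetric]
    by (simp add: power2_norm_eq_inner inner_add inner_axis inner_axis' v_def)
  show "(lattice_norm (n - axis j 1))\<^sup>2 = (lattice_norm n)\<^sup>2 + (1 - 2 * real_of_int (n $ j))"
    unfolding lattice_norm_def q v_def[symmetric]
    by (simp add: power2_norm_eq_inner inner_diff inner_axis inner_axis' v_def)
qed

lemma lattice_norm_sq: "(lattice_norm (n :: int ^ 'n))\<^sup>2 = (\<Sum>j\<in>UNIV. (real_of_int (n $ j))\<^sup>2)"
  unfolding lattice_norm_def power2_norm_eq_inner by (simp add: inner_vec_def power2_eq_square)

text \<open>
  After division by \<open>u\<^bsup>-s\<^esup>\<close>, each neighbour contributes \<open>(1 + d/u)\<^bsup>-s\<^esup>\<close>, which is replaced by its Taylor lower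
  bound of degree \<open>m - 1\<close>; the constant terms cancel against the diagonal term of the Laplacian. The condition
  \<open>|n|\<^sup>2 \<noteq> 1\<close> keeps the origin, where \<open>h\<close> vanishes instead of being \<open>\<beta>\<^bsup>-s\<^esup>\<close>, out of the neighbourhood of \<open>n\<close>.
\<close>

lemma moment_inequality:
  fixes n :: "int ^ 'n"
  defines "s \<equiv> (real CARD('n) - 2) / 4" and "R \<equiv> (lattice_norm n)\<^sup>2"
  assumes s: "s > 0" and \<beta>: "\<beta> > 0" and n: "n \<noteq> 0" "R \<noteq> 1" and m: "even m" "m > 0"
    and ineq: "- discrete_laplacian (hardy_fun \<beta>) n \<ge> hardy_const CARD('n) / R * hardy_fun \<beta> n"
  shows "hardy_const CARD('n) / R
           \<le> - (\<Sum>i=1..<m. ((-s) gchoose i) * neighbour_moment i n / (R + \<beta>) ^ i)"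
proof -
  define u where "u = R + \<beta>"
  have u: "u > 0" using \<beta> by (simp add: u_def R_def add_nonneg_pos)
  define T where "T = (\<lambda>d. \<Sum>i=1..<m. ((-s) gchoose i) * (d / u) ^ i)"
  have hardy: "hardy_fun \<beta> k = ((lattice_norm k)\<^sup>2 + \<beta>) powr (-s)" if "k \<noteq> 0" for k :: "int ^ 'n"
    using that unfolding hardy_fun_def s_def minus_divide_left by simp
  have zero: "lattice_norm (0 :: int ^ 'n) = 0"
    by (simp add: lattice_norm_def zero_vec_def[symmetric])
  have h: "hardy_fun \<beta> k \<ge> u powr (-s) * (1 + T d)"
    if k: "(lattice_norm k)\<^sup>2 = R + d" and "k \<noteq> 0" for k :: "int ^ 'n" and d
  proof -
    have "u + d = (lattice_norm k)\<^sup>2 + \<beta>" using k by (simp add: u_def)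
    then have ud: "u + d > 0" using \<beta> by (simp add: add_nonneg_pos)
    have "{..<m} = insert 0 {1..<m}" using m by auto
    then have "1 + T d = (\<Sum>i<m. ((-s) gchoose i) * (d / u) ^ i)"
      by (simp add: T_def)
    also have "\<dots> \<le> (1 + d / u) powr (-s)"
      using ud u by (intro powr_ge_even_taylor s m) (simp add: field_simps)
    finally have "u powr (-s) * (1 + T d) \<le> u powr (-s) * (1 + d / u) powr (-s)"
      by (intro mult_left_mono) auto
    also have "\<dots> = (u * (1 + d / u)) powr (-s)"
      using ud u by (subst powr_mult) (auto simp: field_simps)
    also have "u * (1 + d / u) = (lattice_norm k)\<^sup>2 + \<beta>"
      using u k by (simp add: field_simps u_def)
    finally show ?thesis using \<open>k \<noteq> 0\<close> by (simp add: hardy)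
  qed
  have hn: "hardy_fun \<beta> n = u powr (-s)"
    using n by (simp add: hardy u_def R_def)
  have nz: "n + axis j 1 \<noteq> 0" "n - axis j 1 \<noteq> 0" for j
  proof -
    have "(lattice_norm (axis j 1 :: int ^ 'n))\<^sup>2 = 1" "(lattice_norm (- axis j 1 :: int ^ 'n))\<^sup>2 = 1"
      using lattice_norm_neighbours[of "0 :: int ^ 'n" j] zero by simp_all
    then show "n + axis j 1 \<noteq> 0" "n - axis j 1 \<noteq> 0"
      using n(2) by (auto simp: R_def add_eq_0_iff2)
  qed
  have "hardy_const CARD('n) / R * u powr (-s)
          \<le> (\<Sum>j\<in>UNIV. - (hardy_fun \<beta> (n + axis j 1) + hardy_fun \<beta> (n - axis j 1) - 2 * u powr (-s)))"
    unfolding sum_negf using ineq by (simp add: discrete_laplacian_def hn)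
  also have "\<dots> \<le> (\<Sum>j\<in>UNIV. - (T (1 + 2 * real_of_int (n $ j)) + T (1 - 2 * real_of_int (n $ j))) * u powr (-s))"
  proof (rule sum_mono)
    fix j
    show "- (hardy_fun \<beta> (n + axis j 1) + hardy_fun \<beta> (n - axis j 1) - 2 * u powr (-s))
      \<le> - (T (1 + 2 * real_of_int (n $ j)) + T (1 - 2 * real_of_int (n $ j))) * u powr (-s)"
      using h[OF lattice_norm_neighbours(1)[of n j, folded R_def] nz(1)]
            h[OF lattice_norm_neighbours(2)[of n j, folded R_def] nz(2)]
      by (simp add: algebra_simps)
  qed
  finally have "hardy_const CARD('n) / R
      \<le> (\<Sum>j\<in>UNIV. - (T (1 + 2 * real_of_int (n $ j)) + T (1 - 2 * real_of_int (n $ j))))"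
    unfolding sum_distrib_right[symmetric] by (rule mult_right_le_imp_le) (use u in simp)
  also have "\<dots> = - (\<Sum>i=1..<m. \<Sum>j\<in>UNIV. ((-s) gchoose i) *
      ((1 + 2 * real_of_int (n $ j)) ^ i + (1 - 2 * real_of_int (n $ j)) ^ i) / u ^ i)"
    unfolding T_def sum_negf power_divide
    by (subst sum.swap) (simp add: sum.distrib[symmetric] distrib_left add_divide_distrib)
  also have "\<dots> = - (\<Sum>i=1..<m. ((-s) gchoose i) * neighbour_moment i n / (R + \<beta>) ^ i)"
    by (simp add: neighbour_moment_def u_def sum_distrib_left sum_divide_distrib)
  finally show ?thesis .
qed

section \<open>Far out on a coordinate axis\<close>

lemma sum_axis:
  fixes g :: "int \<Rightarrow> real"
  shows "(\<Sum>j\<in>UNIV. g ((axis a c :: int ^ 'n) $ j)) = g c + (real CARD('n) - 1) * g 0"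
proof -
  have "(\<Sum>j\<in>UNIV. g ((axis a c :: int ^ 'n) $ j)) = g c + (\<Sum>j\<in>UNIV - {a}. g 0)"
    by (subst sum.remove[of _ a]) (auto simp: axis_def intro!: sum.cong)
  then show ?thesis by (simp add: card_Diff_singleton of_nat_diff)
qed

lemma hardy_const_eq: "hardy_const N = 4 * ((real N - 2) / 4)\<^sup>2"
  by (simp add: hardy_const_def power_divide)

text \<open>
  Degree five is the least odd degree whose Taylor polynomial contains the fourth order term: at \<open>k e\<^sub>a\<close>
  the increments \<open>1 \<plusminus> 2 k\<close> are of order \<open>\<surd>u\<close>, so the power \<open>d\<^sup>4/u\<^sup>4\<close> is of the decisive order \<open>u\<^bsup>-2\<^esup>\<close>, whereas
  the sum of the fifth powers is \<open>O(k\<^sup>4)\<close> and disappears in the limit.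
\<close>

lemma lower_bound_on_shift:
  fixes \<beta> :: real
  defines "s \<equiv> (real CARD('n::finite) - 2) / 4"
  assumes s: "s > 0" and \<beta>: "\<beta> > 0"
    and ineq: "\<And>n :: int ^ 'n. n \<noteq> 0 \<Longrightarrow> - discrete_laplacian (hardy_fun \<beta>) n
             \<ge> hardy_const CARD('n) / (lattice_norm n)\<^sup>2 * hardy_fun \<beta> n"
  shows "4 * \<beta> \<ge> (s + 1) * (4 * s + 2 + 4 / 3 * s * (s + 2))"
proof -
  obtain a :: 'n where True by simp
  have "4 * s = real CARD('n) - 2" by (simp add: s_def)
  then have N: "real CARD('n) = 4 * s + 2" by linarith
  define c3 where "c3 = s * (s + 1) * (s + 2) / 6"
  define c4 where "c4 = s * (s + 1) * (s + 2) * (s + 3) / 24"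
  define c5 where "c5 = s * (s + 1) * (s + 2) * (s + 3) * (s + 4) / 120"
  \<comment> \<open>\<open>u\<^sup>2\<close> times the right-hand side of the moment inequality is \<open>4 s\<^sup>2 u + 4 s (s + 1) \<beta> + P (1/u)\<close>;
    the substitution \<open>k\<^sup>2 = u - \<beta>\<close> makes \<open>P\<close> a polynomial in \<open>w = 1/u\<close>.\<close>
  define P where "P = (\<lambda>w. - s * (s + 1) * (4 * s + 2)
      + c3 * (24 * (1 - \<beta> * w) + (8 * s + 4) * w)
      - c4 * (32 * (1 - \<beta> * w)\<^sup>2 + 48 * (1 - \<beta> * w) * w + (8 * s + 4) * w\<^sup>2)
      + c5 * w * (160 * (1 - \<beta> * w)\<^sup>2 + 80 * (1 - \<beta> * w) * w + (8 * s + 4) * w\<^sup>2))"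
  have bound: "- 4 * s * \<beta> \<le> P (1 / ((real k)\<^sup>2 + \<beta>))" if k: "k \<ge> 2" for k
  proof -
    define n :: "int ^ 'n" where "n = axis a (int k)"
    define q where "q = (real k)\<^sup>2"
    define u where "u = q + \<beta>"
    have R: "(lattice_norm n)\<^sup>2 = q"
      unfolding lattice_norm_sq n_def by (subst sum_axis) (simp add: q_def)
    have q: "q > 1" using k unfolding q_def by (intro one_less_power) auto
    have u: "u > 0" using q \<beta> by (simp add: u_def)
    have "n \<noteq> 0" using k by (simp add: n_def)
    have M: "neighbour_moment i n = (1 + 2 * real k) ^ i + (1 - 2 * real k) ^ i + 2 * (4 * s + 1)" for i
      unfolding neighbour_moment_def n_def by (subst sum_axis) (simp add: N)
    have M': "neighbour_moment 1 n = 8 * s + 4"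
       "neighbour_moment 2 n = 8 * q + (8 * s + 4)"
       "neighbour_moment 3 n = 24 * q + (8 * s + 4)"
       "neighbour_moment 4 n = 32 * q\<^sup>2 + 48 * q + (8 * s + 4)"
       "neighbour_moment 5 n = 160 * q\<^sup>2 + 80 * q + (8 * s + 4)"
      unfolding M q_def by algebra+
    have "{1..<6::nat} = {1,2,3,4,5}" by auto
    then have sum6: "(\<Sum>i=1..<6. f i) = f 1 + f 2 + f 3 + f 4 + f 5" for f :: "nat \<Rightarrow> real"
      by simp
    have g: "(-s) gchoose 1 = - s" "(-s) gchoose 2 = s * (s + 1) / 2" "(-s) gchoose 3 = - c3"
        "(-s) gchoose 4 = c4" "(-s) gchoose 5 = - c5"
      unfolding c3_def c4_def c5_def
      by (simp_all add: gbinomial_prod_rev eval_nat_numeral atLeast0_lessThan_Suc) algebra+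
    have "4 * s\<^sup>2 / q \<le> - (\<Sum>i=1..<6. ((-s) gchoose i) * neighbour_moment i n / u ^ i)"
      using moment_inequality[of \<beta> n 6] ineq[OF \<open>n \<noteq> 0\<close>] s \<beta> q \<open>n \<noteq> 0\<close>
      unfolding R s_def[symmetric] hardy_const_eq u_def by simp
    also have "\<dots> = s * (8 * s + 4) / u - s * (s + 1) / 2 * (8 * q + (8 * s + 4)) / u ^ 2
        + c3 * (24 * q + (8 * s + 4)) / u ^ 3
        - c4 * (32 * q\<^sup>2 + 48 * q + (8 * s + 4)) / u ^ 4
        + c5 * (160 * q\<^sup>2 + 80 * q + (8 * s + 4)) / u ^ 5"
      unfolding sum6 g M' by simp
    finally have "4 * s\<^sup>2 / q * u\<^sup>2 \<le> \<dots> * u\<^sup>2"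
      by (rule mult_right_mono) simp
    also have "\<dots> = 4 * s\<^sup>2 * u + 4 * s * (s + 1) * \<beta> + P (1 / u)"
    proof -
      have q': "q = u - \<beta>" by (simp add: u_def)
      show ?thesis unfolding P_def q' using u
        by (simp add: divide_simps) algebra
    qed
    finally have 1: "4 * s\<^sup>2 / q * u\<^sup>2 \<le> 4 * s\<^sup>2 * u + 4 * s * (s + 1) * \<beta> + P (1 / u)" .
    \<comment> \<open>On the left, dividing by \<open>|n|\<^sup>2\<close> instead of \<open>u\<close> costs a further \<open>4 s\<^sup>2 \<beta>\<close>, which leaves a net gain
      of \<open>4 s \<beta>\<close> from the shift.\<close>
    have "u\<^sup>2 / q = u + \<beta> + \<beta>\<^sup>2 / q"
      using q by (simp add: u_def field_simps power2_eq_square)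
    then have "u\<^sup>2 / q \<ge> u + \<beta>" using q by simp
    then have "4 * s\<^sup>2 * (u\<^sup>2 / q) \<ge> 4 * s\<^sup>2 * (u + \<beta>)" by (intro mult_left_mono) auto
    then have "4 * s\<^sup>2 / q * u\<^sup>2 \<ge> 4 * s\<^sup>2 * (u + \<beta>)" by simp
    moreover have "4 * s\<^sup>2 * u + 4 * s * (s + 1) * \<beta> = 4 * s\<^sup>2 * (u + \<beta>) + 4 * s * \<beta>"
      by (simp add: algebra_simps power2_eq_square)
    ultimately have "- 4 * s * \<beta> \<le> P (1 / u)" using 1 by simp
    then show ?thesis by (simp add: u_def q_def)
  qed
  have "(\<lambda>k. 1 / ((real k)\<^sup>2 + \<beta>)) \<longlonglongrightarrow> 0"
    by real_asymp
  moreover have "isCont P 0" unfolding P_def by (intro continuous_intros)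
  ultimately have "(\<lambda>k. P (1 / ((real k)\<^sup>2 + \<beta>))) \<longlonglongrightarrow> P 0"
    by (rule isCont_tendsto_compose[rotated])
  moreover have "\<forall>\<^sub>F k in sequentially. - 4 * s * \<beta> \<le> P (1 / ((real k)\<^sup>2 + \<beta>))"
    using bound unfolding eventually_sequentially by blast
  ultimately have "- 4 * s * \<beta> \<le> P 0"
    by (rule tendsto_lowerbound) simp
  then have "s * ((s + 1) * (4 * s + 2 + 4 / 3 * s * (s + 2))) \<le> s * (4 * \<beta>)"
    by (simp add: P_def c3_def c4_def field_simps)
  then show ?thesis using s by simp
qed

section \<open>At the sum of two basis vectors\<close>

lemma sum_axis_pair:
  fixes g :: "int \<Rightarrow> real"
  assumes "a \<noteq> b"
  shows "(\<Sum>j\<in>UNIV. g ((axis a 1 + axis b 1 :: int ^ 'n) $ j)) = 2 * g 1 + (real CARD('n) - 2) * g 0"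
proof -
  have "(\<Sum>j\<in>UNIV. g ((axis a 1 + axis b 1 :: int ^ 'n) $ j))
     = (\<Sum>j\<in>{a,b}. g 1) + (\<Sum>j\<in>UNIV - {a,b}. g 0)"
    by (subst sum.subset_diff[of "{a,b}"]) (use assms in \<open>auto simp: axis_def intro!: sum.cong\<close>)
  moreover have "card {a,b} \<le> CARD('n)" by (rule card_mono) auto
  ultimately show ?thesis using assms by (simp add: card_Diff_subset of_nat_diff)
qed

text \<open>
  The increments at \<open>e\<^sub>a + e\<^sub>b\<close> are \<open>3\<close> and \<open>-1\<close>, twice each, and \<open>1\<close> in the \<open>2 (N - 2) = 8 s\<close> remaining directions.
  This is a shortest nonzero lattice point not adjacent to the origin.
\<close>

lemma pair_inequality:
  fixes \<beta> :: real
  defines "s \<equiv> (real CARD('n::finite) - 2) / 4"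
  assumes s: "s > 0" and \<beta>: "\<beta> > 0" and m: "even m" "m > 0"
    and ineq: "\<And>n :: int ^ 'n. n \<noteq> 0 \<Longrightarrow> - discrete_laplacian (hardy_fun \<beta>) n
             \<ge> hardy_const CARD('n) / (lattice_norm n)\<^sup>2 * hardy_fun \<beta> n"
  shows "2 * s\<^sup>2 \<le> - (\<Sum>i=1..<m. ((-s) gchoose i) * (2 * 3 ^ i + 2 * (-1) ^ i + 8 * s) / (2 + \<beta>) ^ i)"
proof -
  have "4 * s = real CARD('n) - 2" by (simp add: s_def)
  then have N: "real CARD('n) = 4 * s + 2" by linarith
  then have "CARD('n) > 1" using s by linarith
  then obtain a b :: 'n where ab: "a \<noteq> b"
    by (metis (full_types) One_nat_def UNIV_I card_le_Suc0_iff_eq finite not_less)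
  define n :: "int ^ 'n" where "n = axis a 1 + axis b 1"
  have R: "(lattice_norm n)\<^sup>2 = 2"
    unfolding lattice_norm_sq n_def by (subst sum_axis_pair[OF ab]) simp
  have "n \<noteq> 0"
  proof
    assume "n = 0"
    then have "n $ a = 0" by simp
    then show False using ab by (simp add: n_def axis_def)
  qed
  have M: "neighbour_moment i n = 2 * 3 ^ i + 2 * (-1) ^ i + 8 * s" for i
    unfolding neighbour_moment_def n_def by (subst sum_axis_pair[OF ab]) (simp add: N)
  show ?thesis
    using moment_inequality[of \<beta> n m] ineq[OF \<open>n \<noteq> 0\<close>] s \<beta> \<open>n \<noteq> 0\<close> m
    unfolding R s_def[symmetric] hardy_const_eq M by simp
qed

theorem proposition3p2:
  assumes "CARD('n::finite) \<ge> 5"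
  shows "\<not> (\<exists>\<beta>>0. \<forall>n :: int ^ 'n. n \<noteq> 0 \<longrightarrow>
           - discrete_laplacian (hardy_fun \<beta>) n
             \<ge> hardy_const CARD('n) / (lattice_norm n)\<^sup>2 * hardy_fun \<beta> n)"
proof
  assume "\<exists>\<beta>>0. \<forall>n :: int ^ 'n. n \<noteq> 0 \<longrightarrow>
           - discrete_laplacian (hardy_fun \<beta>) n
             \<ge> hardy_const CARD('n) / (lattice_norm n)\<^sup>2 * hardy_fun \<beta> n"
  then obtain \<beta> where \<beta>: "\<beta> > 0"
    and ineq: "\<And>n :: int ^ 'n. n \<noteq> 0 \<Longrightarrow> - discrete_laplacian (hardy_fun \<beta>) n
             \<ge> hardy_const CARD('n) / (lattice_norm n)\<^sup>2 * hardy_fun \<beta> n" by blast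
  define s where "s = (real CARD('n) - 2) / 4"
  have s: "s > 0" using assms by (simp add: s_def)
  have lower: "4 * \<beta> \<ge> (s + 1) * (4 * s + 2 + 4 / 3 * s * (s + 2))"
    using lower_bound_on_shift[where 'n = 'n, OF _ \<beta> ineq] s unfolding s_def by blast
  have pair: "2 * s\<^sup>2 \<le> - (\<Sum>i=1..<m. ((-s) gchoose i) * (2 * 3 ^ i + 2 * (-1) ^ i + 8 * s) / (2 + \<beta>) ^ i)"
    if "even m" "m > 0" for m
    using pair_inequality[where 'n = 'n, OF _ \<beta> that ineq] s unfolding s_def by blast
  show False
  proof (cases "CARD('n) = 5")
    case True
    then have s34: "s = 3 / 4" by (simp add: s_def)
    have \<beta>3: "\<beta> > 3" using lower by (simp add: s34)
    define w where "w = 1 / (2 + \<beta>)"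
    have w: "0 < w" "w \<le> 1 / 5" using \<beta>3 by (auto simp: w_def field_simps)
    have "{1..<4::nat} = {1,2,3}" by auto
    then have sum4: "(\<Sum>i=1..<4. f i) = f 1 + f 2 + f 3" for f :: "nat \<Rightarrow> real"
      by simp
    have "even (4::nat)" "(4::nat) > 0" by simp_all
    then have "2 * s\<^sup>2 \<le> 15 / 2 * w - 273 / 16 * w ^ 2 + 2233 / 64 * w ^ 3"
      using pair[of 4] unfolding sum4 w_def s34
      by (simp add: gbinomial_prod_rev eval_nat_numeral atLeast0_lessThan_Suc)
    moreover have "15 / 2 * w - 273 / 16 * w ^ 2 + 2233 / 64 * w ^ 3 < 9 / 8"
    proof -
      \<comment> \<open>Trading the cubic term for a quadratic one leaves a quadratic that is at most \<open>11/10\<close> on \<open>[0, 1/5]\<close>.\<close>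
      have "w ^ 3 \<le> 1 / 5 * w ^ 2"
        using w by (simp add: power3_eq_cube power2_eq_square mult_right_mono)
      moreover have "(1 / 5 - w) * (11 / 2 - 10 * w) \<ge> 0"
        using w by (intro mult_nonneg_nonneg) auto
      moreover have "(1 / 5 - w) * (11 / 2 - 10 * w) = 11 / 10 - 15 / 2 * w + 10 * w ^ 2"
        by (simp add: field_simps power2_eq_square)
      moreover have "w ^ 2 \<ge> 0" by simp
      ultimately show ?thesis by linarith
    qed
    ultimately show False by (simp add: s34 power2_eq_square)
  next
    case False
    then have "CARD('n) \<ge> 6" using assms by simp
    then have s1: "s \<ge> 1" by (simp add: s_def)
    \<comment> \<open>The convexity bound, in the form \<open>2 + \<beta> \<le> (4 s + 2)/s\<close>.\<close>
    have "2 * s\<^sup>2 \<le> s * (8 * s + 4) / (2 + \<beta>)"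
      using pair[of 2] by (simp add: eval_nat_numeral add.commute)
    then have "s * (s * \<beta>) \<le> s * (2 * (s + 1))" using \<beta> by (simp add: field_simps power2_eq_square)
    then have "s * \<beta> \<le> 2 * (s + 1)" using s by simp
    moreover have "s * ((s + 1) * (4 * s + 2 + 4 / 3 * s * (s + 2))) \<le> s * (4 * \<beta>)"
      using lower s by simp
    ultimately have "(s + 1) * (s * (4 * s + 2 + 4 / 3 * s * (s + 2))) \<le> (s + 1) * 8"
      by (simp add: algebra_simps)
    then have "s * (4 * s + 2 + 4 / 3 * s * (s + 2)) \<le> 8"
      by (rule mult_left_le_imp_le) (use s in simp)
    moreover have "1 * (4 * 1 + 2 + 4 / 3 * 1 * (1 + 2)) \<le> s * (4 * s + 2 + 4 / 3 * s * (s + 2))"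
      using s1 by (intro mult_mono add_mono) auto
    ultimately show False by simp
  qed
qed

end
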